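(* Let $\theta>1$ and let the aggregation function $t$ (with $m$ arguments) be monotone. Let $\mathbf{D}$ be the class of all databases (with $m$ sorted lists). Let $\mathbf{A}$ be the class of all algorithms that find a $\theta$-approximation to the top $k$ answers for $t$ for every database and that do not make wild guesses. Then $\mathrm{TA}_\theta$ is instance optimal over $\mathbf{A}$ and $\mathbf{D}$.
   Context: Setting: fix positive integers $m$ and $k$ (treated as constants). A database consists of a finite set of $N\ge k$ objects; each object $R$ has $m$ grades (fields) $x_1,\dots,x_m\in[0,1]$. It is presented as $m$ sorted lists $L_1,\dots,L_m$ of length $N$; list $L_i$ contains one entry $(R,x_i)$ for each object $R$, in descending order of $x_i$ (the order among ties is part of the database). An aggregation function is a fixed function $t:[0,1]^m\to[0,\infty)$; the overall grade of $R$ is $t(R)=t(x_1,\dots,x_m)$. $t$ is monotone if $t(x_1,\dots,x_m)\le t(x_1',\dots,x_m')$ whenever $x_i\le x_i'$ for every $i$. A $\theta$-approximation to the top $k$ answers for $t$ over a database is a collection of $k$ objects (each along with its overall grade) such that for each $y$ among these $k$ objects and each object $z$ not among them, $\theta\, t(y)\ge t(z)$. Access and cost: an algorithm obtains information about the database only by sorted access (reading the next entry of some list, proceeding sequentially from the top) and random access (requesting the grade of a given object in a given list, obtained in one step; the object may be one not previously seen). Internal computation is free. With $s$ sorted and $r$ random accesses the middleware cost is $s c_S+r c_R$, where $c_S,c_R>0$ are fixed constants; $cost(\mathcal A,\mathcal D)$ is the middleware cost of algorithm $\mathcal A$ on database $\mathcal D$. An algorithm makes wild guesses if it does random access to find the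 grade of some object in some list before having seen that object under sorted access. Instance optimality: algorithm $\mathcal B$ is instance optimal over $\mathbf A$ and $\mathbf D$ if $\mathcal B\in\mathbf A$ and there are constants $c,c'$ such that $cost(\mathcal B,\mathcal D)\le c\cdot cost(\mathcal A,\mathcal D)+c'$ for every $\mathcal A\in\mathbf A$ and $\mathcal D\in\mathbf D$. Algorithm $\mathrm{TA}_\theta$: (1) Do sorted access in parallel to each of the $m$ lists (top entry of each list, then second entry of each list, and so on). As an object $R$ is seen under sorted access in some list, do random access to the other lists to find all its grades, and compute $t(R)$. If this grade is one of the $k$ highest seen, remember $R$ and $t(R)$ (ties broken arbitrarily, only $k$ objects remembered). (2) For each $i$ let $\underline{x}_i$ be the grade of the last object seen under sorted access in $L_i$, and let the threshold value be $\tau=t(\underline{x}_1,\dots,\underline{x}_m)$. As soon as at least $k$ objects have been seen whose grade is at least $\tau/\theta$, halt. (3) Output the $k$ seen objects with highest grades, with their grades. *)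

theory Defs
  imports Complex_Main
begin

text \<open>
  A database is given by its sorted lists alone, so that the order among ties is part of it.
  Lists are numbered from \<open>0\<close> to \<open>m - 1\<close>; grade vectors are real lists of length \<open>m\<close>.
\<close>

type_synonym 'o database = "('o \<times> real) list list"

definition objects :: "'o database \<Rightarrow> 'o set" where
  "objects D = (\<Union>L\<in>set D. fst ` set L)"

definition databases :: "nat \<Rightarrow> nat \<Rightarrow> 'o database set" where
  "databases m k = {D. length D = m \<and> k \<le> card (objects D) \<and>
     (\<forall>L\<in>set D. distinct (map fst L) \<and> fst ` set L = objects D \<and>
        sorted_wrt (\<lambda>p q. snd p \<ge> snd q) L \<and> snd ` set L \<subseteq> {0..1})}"

definition overall_grade :: "(real list \<Rightarrow> real) \<Rightarrow> 'o database \<Rightarrow> 'o \<Rightarrow> real" where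
  "overall_grade t D R = t (map (\<lambda>L. the (map_of L R)) D)"

definition grade_vectors :: "nat \<Rightarrow> real list set" where
  "grade_vectors m = {xs. length xs = m \<and> set xs \<subseteq> {0..1}}"

definition aggregation_function :: "nat \<Rightarrow> (real list \<Rightarrow> real) \<Rightarrow> bool" where
  "aggregation_function m t \<longleftrightarrow> (\<forall>xs\<in>grade_vectors m. 0 \<le> t xs)"

definition monotone_aggregation :: "nat \<Rightarrow> (real list \<Rightarrow> real) \<Rightarrow> bool" where
  "monotone_aggregation m t \<longleftrightarrow>
     (\<forall>xs\<in>grade_vectors m. \<forall>ys\<in>grade_vectors m. list_all2 (\<le>) xs ys \<longrightarrow> t xs \<le> t ys)"

definition theta_approximation ::
    "real \<Rightarrow> nat \<Rightarrow> (real list \<Rightarrow> real) \<Rightarrow> 'o database \<Rightarrow> ('o \<times> real) set \<Rightarrow> bool" where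
  "theta_approximation \<theta> k t D out \<longleftrightarrow>
     (\<exists>Y \<subseteq> objects D. card Y = k \<and> out = (\<lambda>R. (R, overall_grade t D R)) ` Y \<and>
        (\<forall>y\<in>Y. \<forall>z\<in>objects D - Y. \<theta> * overall_grade t D y \<ge> overall_grade t D z))"


text \<open>
  Since internal computation is free, a (deterministic) algorithm is an arbitrary function that
  maps the accesses made so far, in chronological order and together with their answers, to its
  next action.
  A sorted access past the end of a list is answered by \<open>None\<close>, and so are accesses to
  non-existing lists or objects; such accesses are charged like all others.
\<close>

datatype 'o event =
    SortedAccess nat "('o \<times> real) option"
  | RandomAccess nat 'o "real option"

type_synonym 'o history = "'o event list"

datatype 'o action = Sorted nat | Random nat 'o | Halt "('o \<times> real) set"

type_synonym 'o algorithm = "'o history \<Rightarrow> 'o action"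

fun is_sorted_access :: "'o event \<Rightarrow> bool" where
  "is_sorted_access (SortedAccess i a) = True"
| "is_sorted_access (RandomAccess i R a) = False"

fun is_sorted_access_to :: "nat \<Rightarrow> 'o event \<Rightarrow> bool" where
  "is_sorted_access_to j (SortedAccess i a) = (i = j)"
| "is_sorted_access_to j (RandomAccess i R a) = False"

definition sorted_answer :: "'o database \<Rightarrow> 'o history \<Rightarrow> nat \<Rightarrow> ('o \<times> real) option" where
  "sorted_answer D h i =
     (let p = length (filter (is_sorted_access_to i) h)
      in if i < length D \<and> p < length (D ! i) then Some (D ! i ! p) else None)"

definition random_answer :: "'o database \<Rightarrow> nat \<Rightarrow> 'o \<Rightarrow> real option" where
  "random_answer D i R = (if i < length D then map_of (D ! i) R else None)"

primrec run :: "'o algorithm \<Rightarrow> 'o database \<Rightarrow> nat \<Rightarrow> 'o history" where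
  "run A D 0 = []"
| "run A D (Suc n) =
     (let h = run A D n
      in h @ (case A h of
                Sorted i \<Rightarrow> [SortedAccess i (sorted_answer D h i)]
              | Random i R \<Rightarrow> [RandomAccess i R (random_answer D i R)]
              | Halt out \<Rightarrow> []))"

definition halts :: "'o algorithm \<Rightarrow> 'o database \<Rightarrow> bool" where
  "halts A D \<longleftrightarrow> (\<exists>n out. A (run A D n) = Halt out)"

text \<open>Meaningful only for an algorithm that halts on the given database.\<close>

definition final_history :: "'o algorithm \<Rightarrow> 'o database \<Rightarrow> 'o history" where
  "final_history A D = run A D (LEAST n. \<exists>out. A (run A D n) = Halt out)"

definition cost :: "real \<Rightarrow> real \<Rightarrow> 'o algorithm \<Rightarrow> 'o database \<Rightarrow> real" where
  "cost cS cR A D =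
     (let h = final_history A D
      in real (length (filter is_sorted_access h)) * cS +
         real (length (filter (\<lambda>e. \<not> is_sorted_access e) h)) * cR)"

definition seen :: "'o history \<Rightarrow> 'o set" where
  "seen h = {R. \<exists>i x. SortedAccess i (Some (R, x)) \<in> set h}"

definition wild_guess :: "'o history \<Rightarrow> bool" where
  "wild_guess h \<longleftrightarrow> (\<exists>h1 i R a h2. h = h1 @ RandomAccess i R a # h2 \<and> R \<notin> seen h1)"

definition approximation_algorithms ::
    "real \<Rightarrow> nat \<Rightarrow> nat \<Rightarrow> (real list \<Rightarrow> real) \<Rightarrow> 'o algorithm set" where
  "approximation_algorithms \<theta> m k t = {A. \<forall>D\<in>databases m k. halts A D \<and>
     (\<exists>out. A (final_history A D) = Halt out \<and> theta_approximation \<theta> k t D out)}"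

definition no_wild_guess_algorithms :: "nat \<Rightarrow> nat \<Rightarrow> 'o algorithm set" where
  "no_wild_guess_algorithms m k =
     {A. \<forall>D\<in>databases m k. \<not> wild_guess (final_history A D)}"

definition instance_optimal ::
    "('a \<Rightarrow> 'd \<Rightarrow> real) \<Rightarrow> 'a \<Rightarrow> 'a set \<Rightarrow> 'd set \<Rightarrow> bool" where
  "instance_optimal cst B As Ds \<longleftrightarrow>
     B \<in> As \<and> (\<exists>c c'. \<forall>A\<in>As. \<forall>D\<in>Ds. cst B D \<le> c * cst A D + c')"


text \<open>The quantities that the threshold algorithm computes from what it has read so far.\<close>

definition known_grade :: "'o history \<Rightarrow> nat \<Rightarrow> 'o \<Rightarrow> real" where
  "known_grade h i R =
     (THE x. SortedAccess i (Some (R, x)) \<in> set h \<or> RandomAccess i R (Some x) \<in> set h)"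

definition known_overall :: "nat \<Rightarrow> (real list \<Rightarrow> real) \<Rightarrow> 'o history \<Rightarrow> 'o \<Rightarrow> real" where
  "known_overall m t h R = t (map (\<lambda>i. known_grade h i R) [0..<m])"

definition last_grade :: "'o history \<Rightarrow> nat \<Rightarrow> real" where
  "last_grade h i = last [x. SortedAccess j (Some (R, x)) \<leftarrow> h, j = i]"

definition last_object :: "'o history \<Rightarrow> 'o" where
  "last_object h = last [R. SortedAccess j (Some (R, x)) \<leftarrow> h]"

definition threshold :: "nat \<Rightarrow> (real list \<Rightarrow> real) \<Rightarrow> 'o history \<Rightarrow> real" where
  "threshold m t h = t (map (last_grade h) [0..<m])"

definition stopping_rule ::
    "real \<Rightarrow> nat \<Rightarrow> nat \<Rightarrow> (real list \<Rightarrow> real) \<Rightarrow> 'o history \<Rightarrow> bool" where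
  "stopping_rule \<theta> m k t h \<longleftrightarrow>
     k \<le> card {R \<in> seen h. known_overall m t h R \<ge> threshold m t h / \<theta>}"

text \<open>
  Ties are broken arbitrarily: \<open>sel h\<close> is any choice of \<open>k\<close> seen objects with the highest
  grades.
\<close>

definition top_choice ::
    "nat \<Rightarrow> nat \<Rightarrow> (real list \<Rightarrow> real) \<Rightarrow> ('o history \<Rightarrow> 'o set) \<Rightarrow> bool" where
  "top_choice m k t sel \<longleftrightarrow> (\<forall>h. k \<le> card (seen h) \<longrightarrow>
     sel h \<subseteq> seen h \<and> card (sel h) = k \<and>
     (\<forall>y\<in>sel h. \<forall>z\<in>seen h - sel h. known_overall m t h y \<ge> known_overall m t h z))"

text \<open>
  One round of parallel sorted access takes \<open>m * m\<close> accesses: for each list \<open>i\<close> in turn, a sorted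
  access to \<open>i\<close>, followed by random accesses to the \<open>m - 1\<close> other lists for the object just seen
  (also if that object has been seen before). The stopping rule is tested after every full round.
\<close>

definition TA ::
    "real \<Rightarrow> nat \<Rightarrow> nat \<Rightarrow> (real list \<Rightarrow> real) \<Rightarrow> ('o history \<Rightarrow> 'o set) \<Rightarrow> 'o algorithm" where
  "TA \<theta> m k t sel h =
     (let r = length h mod (m * m); i = r div m; j = r mod m
      in if r = 0 \<and> h \<noteq> [] \<and> stopping_rule \<theta> m k t h
         then Halt ((\<lambda>R. (R, known_overall m t h R)) ` sel h)
         else if j = 0 then Sorted i
         else Random (filter (\<lambda>l. l \<noteq> i) [0..<m] ! (j - 1)) (last_object h))"

lemma finite_seen: "finite (seen h)"
proof -
  have "seen h \<subseteq>
      (\<lambda>e. case e of SortedAccess i a \<Rightarrow> fst (the a) | RandomAccess i R a \<Rightarrow> R) ` set h"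
    unfolding seen_def by force
  then show ?thesis
    using finite_surj by blast
qed

lemma ex_top_subset:
  fixes f :: "'o \<Rightarrow> real"
  assumes "finite S" "k \<le> card S"
  shows "\<exists>Y\<subseteq>S. card Y = k \<and> (\<forall>y\<in>Y. \<forall>z\<in>S - Y. f y \<ge> f z)"
  using assms(2)
proof (induction k)
  case 0
  then show ?case by (intro exI[of _ "{}"]) auto
next
  case (Suc k)
  then obtain Y where Y: "Y \<subseteq> S" "card Y = k" "\<forall>y\<in>Y. \<forall>z\<in>S - Y. f y \<ge> f z"
    by auto
  have fin: "finite (S - Y)" using assms(1) by simp
  have "S - Y \<noteq> {}"
    using Suc.prems Y(1,2) assms(1) by (metis Diff_eq_empty_iff Suc_n_not_le_n subset_antisym)
  then obtain x where x: "x \<in> S - Y" "\<forall>z\<in>S - Y. f z \<le> f x"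
    using fin Max_in[of "f ` (S - Y)"] Max_ge[of "f ` (S - Y)"] by fastforce
  have "card (insert x Y) = Suc k"
    using x(1) Y(1,2) assms(1) by (simp add: finite_subset)
  then show ?case
    using x Y by (intro exI[of _ "insert x Y"]) auto
qed

lemma ex_top_choice: "\<exists>sel. top_choice m k t sel"
  unfolding top_choice_def
  by (intro choice allI) (meson ex_top_subset finite_seen)

end

theory Submission
  imports Defs
begin

text \<open>
  Suppose that \<open>A\<close> makes \<open>s\<close> sorted accesses on \<open>D\<close>. Then \<open>TA\<close> halts by depth \<open>s + k\<close>, and each of
  its rounds has constant cost. If \<open>D\<close> has at most \<open>s + k\<close> objects, then this holds because \<open>TA\<close>
  halts once it has seen everything. Otherwise \<open>A\<close> only outputs objects that it has seen, as it
  could not tell \<open>D\<close> from \<open>D\<close> without an unseen object. Moreover some object \<open>R\<close> is unseen by \<open>A\<close>,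
  and moving \<open>R\<close> to the first position of each list that \<open>A\<close> has not read, with the grade found
  there, changes nothing that \<open>A\<close> reads. The grade of \<open>R\<close> then is at least the threshold at depth
  \<open>s + 1\<close>, so that the correctness of \<open>A\<close> on the changed database bounds the grades of its output
  from below, and \<open>TA\<close> halts at this depth at the latest.
\<close>

section \<open>Databases\<close>

lemma databaseD:
  assumes "D \<in> databases m k"
  shows "length D = m" "k \<le> card (objects D)"
    and "\<And>i. i < m \<Longrightarrow> distinct (map fst (D ! i))"
    and "\<And>i. i < m \<Longrightarrow> fst ` set (D ! i) = objects D"
    and "\<And>i. i < m \<Longrightarrow> sorted_wrt (\<lambda>p q. snd p \<ge> snd q) (D ! i)"
    and "\<And>i. i < m \<Longrightarrow> snd ` set (D ! i) \<subseteq> {0..1}"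
    and "\<And>i. i < m \<Longrightarrow> length (D ! i) = card (objects D)"
proof -
  show len: "length D = m" and "k \<le> card (objects D)"
    using assms by (auto simp: databases_def)
  fix i assume "i < m"
  then have "D ! i \<in> set D" using len by simp
  then show *: "distinct (map fst (D ! i))" "fst ` set (D ! i) = objects D"
    "sorted_wrt (\<lambda>p q. snd p \<ge> snd q) (D ! i)" "snd ` set (D ! i) \<subseteq> {0..1}"
    using assms by (auto simp: databases_def)
  show "length (D ! i) = card (objects D)"
    using *(1,2) distinct_card[of "map fst (D ! i)"] by simp
qed

lemma finite_objects: "finite (objects D)"
  by (simp add: objects_def)

lemma map_of_eq_Some_iff:
  assumes "D \<in> databases m k" "i < m"
  shows "map_of (D ! i) R = Some x \<longleftrightarrow> (R, x) \<in> set (D ! i)"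
  using databaseD(3)[OF assms] by simp

lemma overall_grade_eq:
  assumes "length D = m"
  shows "overall_grade t D R = t (map (\<lambda>i. the (map_of (D ! i) R)) [0..<m])"
proof -
  have "map (\<lambda>L. the (map_of L R)) D = map (\<lambda>i. the (map_of (D ! i) R)) [0..<m]"
    using assms by (auto intro: nth_equalityI)
  then show ?thesis by (simp add: overall_grade_def)
qed

lemma objects_nth:
  assumes "D \<in> databases m k" "i < m" "R \<in> objects D"
  obtains p where "p < card (objects D)" "fst (D ! i ! p) = R"
proof -
  from assms have "R \<in> fst ` set (D ! i)" by (simp add: databaseD(4))
  then show thesis
    using that databaseD(7)[OF assms(1,2)] by (force simp: in_set_conv_nth)
qed

lemma nth_in_objects:
  assumes "D \<in> databases m k" "i < m" "p < card (objects D)"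
  shows "fst (D ! i ! p) \<in> objects D" "snd (D ! i ! p) \<in> {0..1}"
    "D ! i ! p \<in> set (D ! i)"
    "map_of (D ! i) (fst (D ! i ! p)) = Some (snd (D ! i ! p))"
proof -
  show *: "D ! i ! p \<in> set (D ! i)"
    using assms by (simp add: databaseD(7))
  show "fst (D ! i ! p) \<in> objects D" "snd (D ! i ! p) \<in> {0..1}"
    using * databaseD(4,6)[OF assms(1,2)] by blast+
  show "map_of (D ! i) (fst (D ! i ! p)) = Some (snd (D ! i ! p))"
    using * map_of_eq_Some_iff[OF assms(1,2)] by simp
qed

lemma nth_grade_antimono:
  assumes "D \<in> databases m k" "i < m" "p \<le> q" "q < card (objects D)"
  shows "snd (D ! i ! q) \<le> snd (D ! i ! p)"
  using databaseD(5,7)[OF assms(1,2)] assms(3,4)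
  by (cases "p = q") (auto simp: sorted_wrt_iff_nth_less)

lemma grade_vector_nth:
  assumes "D \<in> databases m k" "\<And>i. i < m \<Longrightarrow> p i < card (objects D)"
  shows "map (\<lambda>i. snd (D ! i ! p i)) [0..<m] \<in> grade_vectors m"
  using nth_in_objects(2)[OF assms(1) _ assms(2)] by (auto simp: grade_vectors_def)

lemma grade_vector_object:
  assumes "D \<in> databases m k" "R \<in> objects D"
  shows "map (\<lambda>i. the (map_of (D ! i) R)) [0..<m] \<in> grade_vectors m"
proof -
  have "the (map_of (D ! i) R) \<in> {0..1}" if i: "i < m" for i
    using objects_nth[OF assms(1) i assms(2)] nth_in_objects(2,4)[OF assms(1) i]
    by (metis option.sel)
  then show ?thesis by (auto simp: grade_vectors_def)
qed

lemma overall_grade_nonneg: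
  assumes "aggregation_function m t" "D \<in> databases m k" "R \<in> objects D"
  shows "0 \<le> overall_grade t D R"
  using assms grade_vector_object[OF assms(2,3)]
  by (simp add: overall_grade_eq databaseD(1)[OF assms(2)] aggregation_function_def)

lemma monotone_aggregationD:
  assumes "monotone_aggregation m t"
    and "map f [0..<m] \<in> grade_vectors m" "map g [0..<m] \<in> grade_vectors m"
    and "\<And>i. i < m \<Longrightarrow> f i \<le> g i"
  shows "t (map f [0..<m]) \<le> t (map g [0..<m])"
  using assms unfolding monotone_aggregation_def by (simp add: list_all2_conv_all_nth)

section \<open>Runs of algorithms\<close>

abbreviation sorted_count :: "'o history \<Rightarrow> nat \<Rightarrow> nat" where
  "sorted_count h i \<equiv> length (filter (is_sorted_access_to i) h)"

text \<open>A sorted answer depends on the history only through the position reached; with the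
  position as an argument, databases can be compared entry by entry.\<close>

definition list_entry :: "'o database \<Rightarrow> nat \<Rightarrow> nat \<Rightarrow> ('o \<times> real) option" where
  "list_entry D i p = (if i < length D \<and> p < length (D ! i) then Some (D ! i ! p) else None)"

lemma sorted_answer_eq: "sorted_answer D h i = list_entry D i (sorted_count h i)"
  by (simp add: sorted_answer_def list_entry_def Let_def)

lemma run_after_halt:
  assumes "A (run A D n) = Halt out" "n \<le> n'"
  shows "run A D n' = run A D n"
  using assms(2)
proof (induction n' rule: dec_induct)
  case (step n')
  then show ?case using assms(1) by (simp add: Let_def)
qed simp

lemma final_history_eq:
  assumes "A (run A D n) = Halt out"
  shows "final_history A D = run A D n"
proof -
  let ?l = "LEAST n. \<exists>out. A (run A D n) = Halt out"
  have "\<exists>out. A (run A D ?l) = Halt out"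
    by (rule LeastI) (rule exI, rule assms)
  then obtain out' where "A (run A D ?l) = Halt out'" ..
  moreover have "?l \<le> n"
    by (rule Least_le) (rule exI, rule assms)
  ultimately have "run A D n = run A D ?l"
    by (rule run_after_halt)
  then show ?thesis
    by (simp add: final_history_def)
qed

text \<open>Each sorted access to list \<open>i\<close> reads the position given by the number of
  earlier accesses to it, so together they cover exactly the positions below the count.\<close>

lemma sorted_access_in_run_iff:
  "SortedAccess i a \<in> set (run A D n) \<longleftrightarrow>
     (\<exists>p < sorted_count (run A D n) i. a = list_entry D i p)"
proof (induction n)
  case (Suc n)
  show ?case
  proof (cases "A (run A D n)")
    case (Sorted j)
    then show ?thesis
      using Suc by (cases "j = i") (auto simp: Let_def sorted_answer_eq Ex_less_Suc)
  qed (use Suc in \<open>simp_all add: Let_def\<close>)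
qed simp

text \<open>A deterministic algorithm that receives the same answers takes the same actions. The
  hypotheses concern only what is accessed on \<open>D\<close>, so nothing has to be known
  beforehand about the run on \<open>D'\<close>.\<close>

lemma run_cong:
  assumes "\<And>i p. p < sorted_count (run A D n) i \<Longrightarrow> list_entry D' i p = list_entry D i p"
    and "\<And>i R a. RandomAccess i R a \<in> set (run A D n) \<Longrightarrow>
           random_answer D' i R = random_answer D i R"
  shows "run A D' n = run A D n"
  using assms
proof (induction n)
  case (Suc n)
  have eq: "run A D' n = run A D n"
  proof (rule Suc.IH)
    fix i p assume "p < sorted_count (run A D n) i"
    then show "list_entry D' i p = list_entry D i p"
      by (intro Suc.prems(1)) (simp add: Let_def)
  next
    fix i R a assume "RandomAccess i R a \<in> set (run A D n)"
    then show "random_answer D' i R = random_answer D i R"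
      by (intro Suc.prems(2)[of i R a]) (simp add: Let_def)
  qed
  show ?case
  proof (cases "A (run A D n)")
    case (Sorted i)
    have "list_entry D' i (sorted_count (run A D n) i) = list_entry D i (sorted_count (run A D n) i)"
      by (rule Suc.prems(1)) (simp add: Let_def Sorted)
    then show ?thesis by (simp add: Let_def eq Sorted sorted_answer_eq)
  next
    case (Random i R)
    have "random_answer D' i R = random_answer D i R"
      by (rule Suc.prems(2)[of i R "random_answer D i R"]) (simp add: Let_def Random)
    then show ?thesis by (simp add: Let_def eq Random)
  qed (simp add: Let_def eq)
qed simp

text \<open>Each sorted access reveals at most one object, so an unseen object remains when there
  are more objects than sorted accesses.\<close>

lemma card_seen_le: "card (seen h) \<le> length (filter is_sorted_access h)"
proof -
  let ?f = "\<lambda>e. case e of SortedAccess i a \<Rightarrow> fst (the a) | RandomAccess i R a \<Rightarrow> R"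
  have "seen h \<subseteq> ?f ` set (filter is_sorted_access h)"
    by (force simp: seen_def)
  then have "card (seen h) \<le> card (set (filter is_sorted_access h))"
    by (meson List.finite_set card_image_le card_mono finite_imageI le_trans)
  also have "\<dots> \<le> length (filter is_sorted_access h)"
    by (rule card_length)
  finally show ?thesis .
qed

lemma sorted_count_le: "sorted_count h i \<le> length (filter is_sorted_access h)"
proof (induction h)
  case (Cons e h)
  then show ?case by (cases e) auto
qed simp

text \<open>Without wild guesses, an object not met under sorted access is not probed at all, so
  random access cannot notice a change of its grades.\<close>

lemma random_access_seen:
  assumes "\<not> wild_guess h" "RandomAccess i R a \<in> set h"
  shows "R \<in> seen h"
proof -
  obtain h1 h2 where h: "h = h1 @ RandomAccess i R a # h2"
    using assms(2) by (meson split_list)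
  then have "R \<in> seen h1" using assms(1) unfolding wild_guess_def by blast
  then show ?thesis by (auto simp: seen_def h)
qed

section \<open>Changing an unseen object\<close>

text \<open>
  The first \<open>c i\<close> entries of list \<open>i\<close> are those that an algorithm has read; \<open>R\<close> is not among them.
  With \<open>X i\<close> empty the object is removed, and with a single entry for \<open>R\<close> it is moved.
\<close>

definition relocate ::
    "'o database \<Rightarrow> 'o \<Rightarrow> (nat \<Rightarrow> nat) \<Rightarrow> (nat \<Rightarrow> ('o \<times> real) list) \<Rightarrow> 'o database" where
  "relocate D R c X = map (\<lambda>i. take (c i) (D ! i) @ X i @
     filter (\<lambda>p. fst p \<noteq> R) (drop (c i) (D ! i))) [0..<length D]"

lemma map_of_filter_fst: "R' \<noteq> R \<Longrightarrow> map_of (filter (\<lambda>p. fst p \<noteq> R) L) R' = map_of L R'"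
  by (induction L) auto

lemma map_of_relocate:
  assumes "i < length D" "fst ` set (X i) \<subseteq> {R}" "R' \<noteq> R"
  shows "map_of (relocate D R c X ! i) R' = map_of (D ! i) R'"
proof -
  have "map_of (X i) R' = None"
    using assms by (auto simp: map_of_eq_None_iff)
  moreover have "map_of (D ! i) R' = map_of (take (c i) (D ! i) @ drop (c i) (D ! i)) R'"
    by simp
  ultimately show ?thesis
    using assms
    by (simp add: relocate_def map_add_def map_of_filter_fst del: append_take_drop_id
        split: option.split)
qed

text \<open>Every list contains \<open>R\<close>, so reading one to its end would have revealed it.
  Hence position \<open>c\<close>, the first unread one, exists.\<close>

lemma unseen_count:
  assumes D: "D \<in> databases m k" and i: "i < m" and R: "R \<in> objects D" "R \<notin> seen (run A D n)"
  defines "c \<equiv> sorted_count (run A D n) i"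
  shows "c < card (objects D)" "R \<notin> fst ` set (take c (D ! i))"
proof -
  \<comment> \<open>The bound by the number of objects matters because accesses past the end are
    counted but show nothing.\<close>
  have *: "fst (D ! i ! p) \<noteq> R" if "p < c" "p < card (objects D)" for p
  proof
    assume "fst (D ! i ! p) = R"
    then have "SortedAccess i (Some (R, snd (D ! i ! p))) \<in> set (run A D n)"
      using that i databaseD(1,7)[OF D]
      by (auto simp: sorted_access_in_run_iff c_def list_entry_def intro!: exI[of _ p])
    then show False using R by (auto simp: seen_def)
  qed
  then show "R \<notin> fst ` set (take c (D ! i))"
    using databaseD(7)[OF D i] by (fastforce simp: in_set_conv_nth)
  obtain p where "p < card (objects D)" "fst (D ! i ! p) = R"
    using objects_nth[OF D i R(1)] .
  with *[of p] show "c < card (objects D)" by (meson le_less_trans not_le)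
qed

text \<open>The read prefixes are kept and no random access concerns \<open>R\<close>, so the
  algorithm receives the same answers and halts with the same output.\<close>

lemma final_history_relocate:
  assumes D: "D \<in> databases m k" and halt: "A (run A D n) = Halt out"
    and R: "R \<in> objects D" "R \<notin> seen (run A D n)" and nwg: "\<not> wild_guess (run A D n)"
    and X: "\<And>i. i < m \<Longrightarrow> fst ` set (X i) \<subseteq> {R}"
  shows "final_history A (relocate D R (sorted_count (run A D n)) X) = run A D n"
proof -
  let ?c = "sorted_count (run A D n)"
  let ?D' = "relocate D R ?c X"
  have len: "length D = m" "length ?D' = m"
    using databaseD(1)[OF D] by (simp_all add: relocate_def)
  have "run A ?D' n = run A D n"
  proof (rule run_cong)
    fix i p assume p: "p < ?c i"
    show "list_entry ?D' i p = list_entry D i p"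
    proof (cases "i < m")
      case True
      then have "?c i < length (D ! i)"
        using unseen_count[OF D True R] databaseD(7)[OF D] by simp
      then show ?thesis
        using p True len by (simp add: list_entry_def relocate_def nth_append)
    qed (simp add: list_entry_def len)
  next
    fix i R' a assume "RandomAccess i R' a \<in> set (run A D n)"
    then have "R' \<noteq> R"
      using random_access_seen[OF nwg] R by blast
    then show "random_answer ?D' i R' = random_answer D i R'"
      using map_of_relocate[of i D X R R'] X by (auto simp: random_answer_def len)
  qed
  then show ?thesis
    using final_history_eq[of A ?D' n out] halt by simp
qed

lemma overall_grade_relocate:
  assumes "length D = m" "\<And>i. i < m \<Longrightarrow> fst ` set (X i) \<subseteq> {R}" "R' \<noteq> R"
  shows "overall_grade t (relocate D R c X) R' = overall_grade t D R'"
proof -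
  have "map (\<lambda>i. the (map_of (relocate D R c X ! i) R')) [0..<m] =
      map (\<lambda>i. the (map_of (D ! i) R')) [0..<m]"
    using assms by (auto simp: map_of_relocate)
  moreover have "length (relocate D R c X) = m"
    using assms(1) by (simp add: relocate_def)
  ultimately show ?thesis using assms(1) by (simp only: overall_grade_eq)
qed

lemma filter_fst_split:
  assumes "R \<notin> fst ` set (take c L)"
  shows "filter (\<lambda>p. fst p \<noteq> R) L = take c L @ filter (\<lambda>p. fst p \<noteq> R) (drop c L)"
proof -
  have "filter (\<lambda>p. fst p \<noteq> R) (take c L) = take c L"
    using assms by (intro filter_True) auto
  then show ?thesis
    by (metis append_take_drop_id filter_append)
qed

text \<open>As \<open>R\<close> lies outside the kept prefixes, the construction just filters it out
  of each list, which preserves order and distinctness. The strict bound on \<open>k\<close> leaves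
  at least \<open>k\<close> objects.\<close>

lemma relocate_remove:
  assumes D: "D \<in> databases m k" and m: "1 \<le> m" and R: "R \<in> objects D"
    and c: "\<And>i. i < m \<Longrightarrow> R \<notin> fst ` set (take (c i) (D ! i))"
    and k: "k < card (objects D)"
  shows "relocate D R c (\<lambda>i. []) \<in> databases m k"
    and "objects (relocate D R c (\<lambda>i. [])) = objects D - {R}"
proof -
  let ?D' = "relocate D R c (\<lambda>i. [])"
  have eq: "?D' = map (\<lambda>i. filter (\<lambda>p. fst p \<noteq> R) (D ! i)) [0..<m]"
    using databaseD(1)[OF D] filter_fst_split[OF c] by (simp add: relocate_def)
  have fst: "fst ` set (filter (\<lambda>p. fst p \<noteq> R) (D ! i)) = objects D - {R}" if "i < m" for i
    using databaseD(4)[OF D that] by auto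
  show obj: "objects ?D' = objects D - {R}"
    using fst m by (auto simp: eq objects_def[of "map _ _"])
  have "k \<le> card (objects ?D')"
    using k R by (simp add: obj finite_objects)
  moreover have "snd ` set (filter (\<lambda>p. fst p \<noteq> R) (D ! i)) \<subseteq> {0..1}" if "i < m" for i
    using databaseD(6)[OF D that] by auto
  ultimately show "?D' \<in> databases m k"
    unfolding databases_def eq using obj[unfolded eq] fst databaseD(3,5)[OF D]
    by (simp add: sorted_wrt_filter distinct_map_filter del: set_filter)
qed

text \<open>The grade at position \<open>c i\<close> is at most every grade before it and at least
  every grade after it, so \<open>R\<close> fits there without breaking the order. The filter drops
  the old entry of \<open>R\<close>, which keeps the objects of the list distinct.\<close>

lemma relocate_insert:
  assumes D: "D \<in> databases m k" and m: "1 \<le> m" and R: "R \<in> objects D"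
    and c: "\<And>i. i < m \<Longrightarrow> R \<notin> fst ` set (take (c i) (D ! i))"
    and cN: "\<And>i. i < m \<Longrightarrow> c i < card (objects D)"
  defines "D' \<equiv> relocate D R c (\<lambda>i. [(R, snd (D ! i ! c i))])"
  shows "D' \<in> databases m k" and "objects D' = objects D"
    and "overall_grade t D' R = t (map (\<lambda>i. snd (D ! i ! c i)) [0..<m])"
proof -
  have len: "length D' = m" using databaseD(1)[OF D] by (simp add: D'_def relocate_def)
  let ?L = "\<lambda>i. take (c i) (D ! i) @ (R, snd (D ! i ! c i)) #
    filter (\<lambda>p. fst p \<noteq> R) (drop (c i) (D ! i))"
  have nth: "D' ! i = ?L i" if "i < m" for i
    using that databaseD(1)[OF D] by (simp add: D'_def relocate_def)
  have fst: "fst ` set (D' ! i) = objects D" if i: "i < m" for i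
  proof -
    have "fst ` set (D' ! i) = insert R (fst ` set (filter (\<lambda>p. fst p \<noteq> R) (D ! i)))"
      using filter_fst_split[OF c[OF i]] by (auto simp: nth[OF i])
    also have "\<dots> = insert R (objects D)"
      using databaseD(4)[OF D i] by auto
    finally show ?thesis using R by auto
  qed
  show obj: "objects D' = objects D"
  proof -
    have "set D' = (\<lambda>i. D' ! i) ` {..<m}"
      using len by (auto simp: set_conv_nth)
    then have "objects D' = (\<Union>i<m. fst ` set (D' ! i))"
      by (simp add: objects_def)
    also have "\<dots> = objects D"
      using fst m by (auto simp: lessThan_empty_iff)
    finally show ?thesis .
  qed
  have distinct: "distinct (map fst (D' ! i))" if i: "i < m" for i
  proof -
    have "distinct (map fst (filter (\<lambda>p. fst p \<noteq> R) (D ! i)))"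
      using databaseD(3)[OF D i] by (rule distinct_map_filter)
    then show ?thesis
      using c[OF i] by (auto simp: filter_fst_split[OF c[OF i]] nth[OF i])
  qed
  have sorted: "sorted_wrt (\<lambda>p q. snd p \<ge> snd q) (D' ! i)" if i: "i < m" for i
  proof -
    have ci: "c i < length (D ! i)" using cN[OF i] databaseD(7)[OF D i] by simp
    have s: "sorted_wrt (\<lambda>p q. snd p \<ge> snd q) (filter (\<lambda>p. fst p \<noteq> R) (D ! i))"
      using databaseD(5)[OF D i] by (rule sorted_wrt_filter)
    have "snd (D ! i ! c i) \<le> snd p" if "p \<in> set (take (c i) (D ! i))" for p
      using that ci nth_grade_antimono[OF D i _ cN[OF i]]
      by (auto simp: in_set_conv_nth)
    moreover have "snd p \<le> snd (D ! i ! c i)" if "p \<in> set (drop (c i) (D ! i))" for p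
      using that ci nth_grade_antimono[OF D i, of "c i"] databaseD(7)[OF D i]
      by (auto simp: in_set_conv_nth)
    ultimately show ?thesis
      using s by (auto simp: filter_fst_split[OF c[OF i]] nth[OF i] sorted_wrt_append)
  qed
  have snd: "snd ` set (D' ! i) \<subseteq> {0..1}" if i: "i < m" for i
    using databaseD(6)[OF D i] nth_in_objects(2)[OF D i cN[OF i]]
    by (auto simp: nth[OF i] dest!: in_set_takeD in_set_dropD)
  show db: "D' \<in> databases m k"
    unfolding databases_def
    using len databaseD(2)[OF D] fst distinct sorted snd obj
    by (simp add: all_set_conv_all_nth)
  have *: "the (map_of (D' ! i) R) = snd (D ! i ! c i)" if i: "i < m" for i
  proof -
    have "(R, snd (D ! i ! c i)) \<in> set (D' ! i)" by (simp add: nth[OF i])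
    then have "map_of (D' ! i) R = Some (snd (D ! i ! c i))"
      by (simp only: map_of_eq_Some_iff[OF db i])
    then show ?thesis by simp
  qed
  have "map (\<lambda>i. the (map_of (D' ! i) R)) [0..<m] = map (\<lambda>i. snd (D ! i ! c i)) [0..<m]"
    by (simp add: *)
  then show "overall_grade t D' R = t (map (\<lambda>i. snd (D ! i ! c i)) [0..<m])"
    by (simp only: overall_grade_eq[OF len])
qed

section \<open>Lower bound for competing algorithms\<close>

lemma approximation_algorithm_output:
  assumes D: "D \<in> databases m k" and A: "A \<in> approximation_algorithms \<theta> m k t"
    and halt: "A (final_history A D) = Halt out"
  shows "fst ` out \<subseteq> objects D" "card (fst ` out) = k"
    "\<And>y z. y \<in> fst ` out \<Longrightarrow> z \<in> objects D - fst ` out \<Longrightarrow>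
       overall_grade t D z \<le> \<theta> * overall_grade t D y"
proof -
  have "theta_approximation \<theta> k t D out"
    using D A halt by (force simp: approximation_algorithms_def)
  then obtain Y where Y: "Y \<subseteq> objects D" "card Y = k" "out = (\<lambda>R. (R, overall_grade t D R)) ` Y"
    "\<forall>y\<in>Y. \<forall>z\<in>objects D - Y. \<theta> * overall_grade t D y \<ge> overall_grade t D z"
    unfolding theta_approximation_def by blast
  have "fst ` out = Y" using Y(3) by force
  then show "fst ` out \<subseteq> objects D" "card (fst ` out) = k"
    "\<And>y z. y \<in> fst ` out \<Longrightarrow> z \<in> objects D - fst ` out \<Longrightarrow>
       overall_grade t D z \<le> \<theta> * overall_grade t D y"
    using Y by auto
qed

text \<open>\<open>Y\<close> is the set of objects that \<open>A\<close> outputs. It will witness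
  the stopping rule of \<open>TA\<close> after \<open>Suc s\<close> rounds: position
  \<open>s\<close> is the last one read by then, so its grades form the threshold.\<close>

lemma lower_bound:
  assumes m: "1 \<le> m" and D: "D \<in> databases m k"
    and mono: "monotone_aggregation m t"
    and A: "A \<in> approximation_algorithms \<theta> m k t" "A \<in> no_wild_guess_algorithms m k"
    and large: "length (filter is_sorted_access (final_history A D)) + k < card (objects D)"
  defines "s \<equiv> length (filter is_sorted_access (final_history A D))"
  shows "\<exists>Y \<subseteq> {fst (D ! i ! q) | i q. i < m \<and> q < s}. card Y = k \<and>
    (\<forall>y\<in>Y. t (map (\<lambda>i. snd (D ! i ! s)) [0..<m]) \<le> \<theta> * overall_grade t D y)"
proof -
  obtain n out where halt: "A (run A D n) = Halt out"
    using D A by (auto simp: approximation_algorithms_def halts_def)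
  define h where "h = run A D n"
  define c where "c = sorted_count h"
  have fin: "final_history A D = h" using final_history_eq[of A D n] halt by (simp add: h_def)
  have nwg: "\<not> wild_guess h" using A(2) D fin by (auto simp: no_wild_guess_algorithms_def)
  have s: "s = length (filter is_sorted_access h)" by (simp add: s_def fin)
  have cs: "c i \<le> s" for i
    unfolding s c_def by (rule sorted_count_le)
  have len: "length D = m" by (rule databaseD(1)[OF D])
  define Y where "Y = fst ` out"
  \<comment> \<open>The output objects are the first components of \<open>out\<close>, whatever the
    database is, so the same \<open>Y\<close> can be judged over \<open>D\<close> and over both
    modified databases.\<close>
  note outY = approximation_algorithm_output[OF _ A(1), of _ out, folded Y_def]
  have Y: "Y \<subseteq> objects D" "card Y = k"
    using outY[OF D] halt fin by (auto simp: h_def)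
  have seen: "Y \<subseteq> seen h"
  proof
    fix y assume "y \<in> Y"
    show "y \<in> seen h"
    proof (rule ccontr)
      assume y: "y \<notin> seen h"
      have "y \<in> objects D" using \<open>y \<in> Y\<close> Y by blast
      \<comment> \<open>Deleting \<open>y\<close> leaves the run unchanged, so \<open>A\<close>
        would output an object that the database lacks.\<close>
      let ?D' = "relocate D y c (\<lambda>i. [])"
      have *: "?D' \<in> databases m k" "objects ?D' = objects D - {y}"
        using relocate_remove[OF D m \<open>y \<in> objects D\<close>, of c] large
          unseen_count(2)[OF D _ \<open>y \<in> objects D\<close>, of _ A n] y
        by (auto simp: c_def h_def)
      have "final_history A ?D' = h"
        unfolding c_def h_def
        using y nwg D halt \<open>y \<in> objects D\<close>
        by (intro final_history_relocate[where out = out]) (simp_all add: h_def)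
      then have "Y \<subseteq> objects ?D'"
        using outY(1)[OF *(1)] halt by (simp add: h_def)
      then show False using *(2) \<open>y \<in> Y\<close> by blast
    qed
  qed
  \<comment> \<open>At most \<open>s\<close> objects are seen, fewer than there are, so some object
    can be moved. As all of \<open>Y\<close> is seen, this object is not in the output.\<close>
  have "card (seen h) < card (objects D)"
    using card_seen_le[of h] large by (simp add: fin)
  then have "\<not> objects D \<subseteq> seen h"
    using card_mono[OF finite_seen] by (metis not_le)
  then obtain R where R: "R \<in> objects D" "R \<notin> seen h" by blast
  define X where "X = (\<lambda>i. [(R, snd (D ! i ! c i))])"
  define D' where "D' = relocate D R c X"
  have unseen: "c i < card (objects D)" "R \<notin> fst ` set (take (c i) (D ! i))" if "i < m" for i
    using unseen_count[OF D that R(1), of A n] R(2) by (simp_all add: c_def h_def)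
  have D': "D' \<in> databases m k" "objects D' = objects D"
    "overall_grade t D' R = t (map (\<lambda>i. snd (D ! i ! c i)) [0..<m])"
    unfolding D'_def X_def using relocate_insert[OF D m R(1), of c] unseen by auto
  have fin': "final_history A D' = h"
    unfolding D'_def c_def h_def
    using R nwg D halt
    by (intro final_history_relocate[where out = out]) (simp_all add: h_def X_def)
  have "t (map (\<lambda>i. snd (D ! i ! s)) [0..<m]) \<le> \<theta> * overall_grade t D y" if "y \<in> Y" for y
  proof -
    \<comment> \<open>As \<open>R\<close> is not output, the guarantee over \<open>D'\<close>
      compares its new grade with that of \<open>y\<close>, which the move has not changed.\<close>
    have "R \<in> objects D' - Y" using R seen D'(2) by blast
    then have "overall_grade t D' R \<le> \<theta> * overall_grade t D' y"
      using outY(3)[OF D'(1) _ that] fin' halt by (simp add: h_def)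
    moreover have "overall_grade t D' y = overall_grade t D y"
      unfolding D'_def using R seen that
      by (intro overall_grade_relocate[OF len]) (auto simp: X_def)
    \<comment> \<open>List \<open>i\<close> has been read to depth \<open>c i \<le> s\<close>, so
      the new grade of \<open>R\<close> in it is at least the grade at position \<open>s\<close>,
      which exists by \<open>large\<close>.\<close>
    moreover have "t (map (\<lambda>i. snd (D ! i ! s)) [0..<m]) \<le> overall_grade t D' R"
      unfolding D'(3) using large cs unseen
      by (intro monotone_aggregationD[OF mono] grade_vector_nth[OF D] nth_grade_antimono[OF D])
        (auto simp: s_def)
    ultimately show ?thesis by simp
  qed
  moreover have "Y \<subseteq> {fst (D ! i ! q) | i q. i < m \<and> q < s}"
  proof
    fix y assume "y \<in> Y"
    then obtain i x where "SortedAccess i (Some (y, x)) \<in> set h"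
      using seen by (auto simp: seen_def)
    then obtain p where "p < c i" "Some (y, x) = list_entry D i p"
      by (auto simp: h_def c_def sorted_access_in_run_iff)
    then show "y \<in> {fst (D ! i ! q) | i q. i < m \<and> q < s}"
      using cs[of i] len
      by (intro CollectI exI[of _ i] exI[of _ p])
        (auto simp: list_entry_def split: if_splits dest: arg_cong[of _ _ fst])
  qed
  ultimately show ?thesis using Y(2) by (intro exI[of _ Y] conjI ballI)
qed

section \<open>The run of the threshold algorithm\<close>

text \<open>Access number \<open>n\<close> of \<open>TA\<close>, counted from \<open>0\<close> and provided that it has not halted before.\<close>

definition ta_event :: "nat \<Rightarrow> 'o database \<Rightarrow> nat \<Rightarrow> 'o event" where
  "ta_event m D n =
     (let q = n div (m * m); r = n mod (m * m); i = r div m; j = r mod m;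
        l = filter (\<lambda>l. l \<noteq> i) [0..<m] ! (j - 1); R = fst (D ! i ! q)
      in if j = 0 then SortedAccess i (Some (D ! i ! q))
         else RandomAccess l R (random_answer D l R))"

text \<open>This closed form does not mention the stopping rule, so the rule can be discussed at any
  depth; \<open>run_TA\<close> identifies it with the actual run up to halting.\<close>

definition ta_history :: "nat \<Rightarrow> 'o database \<Rightarrow> nat \<Rightarrow> 'o history" where
  "ta_history m D n = map (ta_event m D) [0..<n]"

lemma ta_history_Suc: "ta_history m D (Suc n) = ta_history m D n @ [ta_event m D n]"
  by (simp add: ta_history_def)

section \<open>Arithmetic of access numbers\<close>

lemma offset_less:
  fixes m i j :: nat
  assumes "i < m" "j < m"
  shows "i * m + j < m * m"
proof -
  have "i * m + j < Suc i * m" using assms(2) by simp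
  also have "\<dots> \<le> m * m" using assms(1) by (intro mult_le_mono1) simp
  finally show ?thesis .
qed

text \<open>An access number is split into the round \<open>q\<close>, the list \<open>i\<close>
  whose entry is processed, and the step \<open>j\<close>: step 0 is the sorted access, the others
  are the random accesses for the object found.\<close>

lemma access_index:
  fixes m q i j :: nat
  assumes "i < m" "j < m"
  shows "(q * (m * m) + (i * m + j)) div (m * m) = q"
    and "(q * (m * m) + (i * m + j)) mod (m * m) = i * m + j"
proof -
  have "0 < m * m" using assms(1) by simp
  then show "(q * (m * m) + (i * m + j)) div (m * m) = q"
    "(q * (m * m) + (i * m + j)) mod (m * m) = i * m + j"
    using offset_less[OF assms] by (simp_all only: div_mult_self3 mod_mult_self3 div_less mod_less)
qed

lemma access_index_cases:
  fixes m n d :: nat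
  assumes "n < d * (m * m)"
  obtains q i j where "n = q * (m * m) + (i * m + j)" "q < d" "i < m" "j < m"
proof
  have "0 < m" using assms by (cases m) auto
  then have "n mod (m * m) < m * m" by simp
  then show "n mod (m * m) div m < m" by (rule less_mult_imp_div_less)
  show "n mod (m * m) mod m < m" using \<open>0 < m\<close> by simp
  show "n div (m * m) < d" using assms by (rule less_mult_imp_div_less)
  show "n = n div (m * m) * (m * m) + (n mod (m * m) div m * m + n mod (m * m) mod m)"
    by (simp only: div_mult_mod_eq)
qed

lemma ta_event_sorted:
  assumes "i < m"
  shows "ta_event m D (q * (m * m) + i * m) = SortedAccess i (Some (D ! i ! q))"
  using access_index[of i m 0 q] assms by (simp add: ta_event_def Let_def)

lemma ta_event_random:
  assumes "i < m" "0 < j" "j < m"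
  shows "ta_event m D (q * (m * m) + (i * m + j)) =
    RandomAccess (filter (\<lambda>l. l \<noteq> i) [0..<m] ! (j - 1)) (fst (D ! i ! q))
      (random_answer D (filter (\<lambda>l. l \<noteq> i) [0..<m] ! (j - 1)) (fst (D ! i ! q)))"
  using access_index[OF assms(1,3), of q] assms by (simp add: ta_event_def Let_def)

lemma is_sorted_access_to_ta_event:
  assumes "0 < m"
  shows "is_sorted_access_to i (ta_event m D n) \<longleftrightarrow> n mod (m * m) = i * m"
proof -
  have "is_sorted_access_to i (ta_event m D n) \<longleftrightarrow>
      n mod (m * m) mod m = 0 \<and> n mod (m * m) div m = i"
    by (simp add: ta_event_def Let_def)
  also have "\<dots> \<longleftrightarrow> n mod (m * m) = i * m"
    using assms div_mult_mod_eq[of "n mod (m * m)" m] by auto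
  finally show ?thesis .
qed

text \<open>When round \<open>q\<close> reaches list \<open>i\<close>, this list has been read once
  in each of the \<open>q\<close> earlier rounds, at the access numbers
  \<open>p * (m * m) + i * m\<close> with \<open>p < q\<close>. So the next sorted access reads
  position \<open>q\<close>.\<close>

lemma sorted_count_ta_history:
  assumes "i < m"
  shows "sorted_count (ta_history m D (q * (m * m) + i * m)) i = q"
proof -
  let ?n = "q * (m * m) + i * m"
  have m: "0 < m" and im: "i * m < m * m" using assms by simp_all
  have "sorted_count (ta_history m D ?n) i = card {n. n < ?n \<and> n mod (m * m) = i * m}"
    unfolding length_filter_conv_card
    by (rule arg_cong[of _ _ card])
      (auto simp: ta_history_def is_sorted_access_to_ta_event[OF m])
  also have "{n. n < ?n \<and> n mod (m * m) = i * m} = (\<lambda>p. p * (m * m) + i * m) ` {..<q}"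
  proof (intro equalityI subsetI)
    fix n assume "n \<in> {n. n < ?n \<and> n mod (m * m) = i * m}"
    then have n: "n < ?n" "n mod (m * m) = i * m" by auto
    have "n = n div (m * m) * (m * m) + i * m"
      using div_mult_mod_eq[of n "m * m"] n(2) by simp
    moreover from this n(1) have "n div (m * m) * (m * m) < q * (m * m)" by linarith
    then have "n div (m * m) < q" using mult_less_cancel2 by blast
    ultimately show "n \<in> (\<lambda>p. p * (m * m) + i * m) ` {..<q}" by blast
  next
    fix n assume "n \<in> (\<lambda>p. p * (m * m) + i * m) ` {..<q}"
    then obtain p where "p < q" "n = p * (m * m) + i * m" by auto
    then show "n \<in> {n. n < ?n \<and> n mod (m * m) = i * m}"
      using im m by simp
  qed
  also have "card \<dots> = q"
    using m by (subst card_image) (auto simp: inj_on_def)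
  finally show ?thesis .
qed

section \<open>Last object and last grades read\<close>

lemma last_object_sorted: "last_object (h @ [SortedAccess i (Some (R, x))]) = R"
  by (simp add: last_object_def)

lemma last_object_random: "last_object (h @ [RandomAccess i R a]) = last_object h"
  by (simp add: last_object_def)

text \<open>Random accesses do not affect \<open>last_object\<close>, so it stays fixed while the
  other grades are fetched. The induction starts right after the sorted access.\<close>

lemma last_object_ta_history:
  assumes "i < m" "1 \<le> j" "j < m"
  shows "last_object (ta_history m D (q * (m * m) + (i * m + j))) = fst (D ! i ! q)"
  using assms(2,3)
proof (induction j rule: dec_induct)
  case base
  have "ta_history m D (q * (m * m) + (i * m + 1)) =
      ta_history m D (q * (m * m) + i * m) @ [SortedAccess i (Some (D ! i ! q))]"
    using ta_history_Suc[of m D "q * (m * m) + i * m"] ta_event_sorted[OF assms(1)] by simp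
  then show ?case
    using last_object_sorted[of _ i "fst (D ! i ! q)" "snd (D ! i ! q)"] by simp
next
  case (step j)
  have "ta_history m D (q * (m * m) + (i * m + Suc j)) =
      ta_history m D (q * (m * m) + (i * m + j)) @ [ta_event m D (q * (m * m) + (i * m + j))]"
    using ta_history_Suc[of m D "q * (m * m) + (i * m + j)"] by simp
  then show ?case
    using step ta_event_random[OF assms(1), of j D q] by (simp add: last_object_random)
qed

lemma last_grade_sorted: "last_grade (h @ [SortedAccess i (Some (R, x))]) i = x"
  by (simp add: last_grade_def)

lemma last_grade_append:
  assumes "\<And>e. e \<in> set g \<Longrightarrow> \<not> is_sorted_access_to i e"
  shows "last_grade (h @ g) i = last_grade h i"
proof -
  have "[x. SortedAccess j (Some (R, x)) \<leftarrow> g, j = i] = []"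
    using assms by (force split: event.split option.split)
  then show ?thesis by (simp add: last_grade_def)
qed

text \<open>The only sorted access to list \<open>i\<close> in round \<open>q\<close> is access
  number \<open>q * (m * m) + i * m\<close>. The history is cut there, and the rest of the round
  cannot change \<open>last_grade\<close>.\<close>

lemma last_grade_ta_history:
  assumes "i < m"
  shows "last_grade (ta_history m D (Suc q * (m * m))) i = snd (D ! i ! q)"
proof -
  let ?n = "q * (m * m) + i * m"
  have m: "0 < m" and im: "i * m < m * m" using assms by simp_all
  have less: "?n < Suc q * (m * m)" using im by simp
  have split: "[0..<Suc q * (m * m)] = [0..<?n] @ ?n # [Suc ?n..<Suc q * (m * m)]"
    unfolding upt_conv_Cons[OF less, symmetric]
    using less upt_add_eq_append[of 0 ?n "Suc q * (m * m) - ?n"]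
    by (simp only: le_add_diff_inverse less_imp_le zero_le)
  have "\<not> is_sorted_access_to i e" if e: "e \<in> ta_event m D ` {Suc ?n..<Suc q * (m * m)}" for e
  proof -
    obtain n where "e = ta_event m D n" "n \<in> {Suc ?n..<Suc q * (m * m)}"
      using e by (rule imageE)
    then have n: "e = ta_event m D n" "?n < n" "n < Suc q * (m * m)"
      by (simp_all only: atLeastLessThan_iff Suc_le_eq)
    have "n div (m * m) = q" using n(2,3) by (intro div_nat_eqI) (simp_all add: algebra_simps)
    then have "n mod (m * m) \<noteq> i * m"
      using div_mult_mod_eq[of n "m * m"] n(2) by auto
    then show ?thesis by (simp add: n(1) is_sorted_access_to_ta_event[OF m])
  qed
  then have *: "last_grade (h @ map (ta_event m D) [Suc ?n..<Suc q * (m * m)]) i = last_grade h i"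
    for h by (intro last_grade_append) (simp only: set_map set_upt not_False_eq_True)
  have "ta_history m D (Suc q * (m * m)) =
    (ta_history m D ?n @ [SortedAccess i (Some (fst (D ! i ! q), snd (D ! i ! q)))]) @
    map (ta_event m D) [Suc ?n..<Suc q * (m * m)]"
    unfolding ta_history_def split using ta_event_sorted[OF assms, of D q] by simp
  then show ?thesis by (simp only: * last_grade_sorted snd_conv)
qed

section \<open>Events and known grades after full rounds\<close>

lemma length_filter_neq:
  assumes "i < m"
  shows "length (filter (\<lambda>l. l \<noteq> i) [0..<m]) = m - 1"
proof -
  have "length (filter (\<lambda>l. l \<noteq> i) [0..<m]) = card (set (filter (\<lambda>l. l \<noteq> i) [0..<m]))"
    by (rule distinct_card[symmetric]) simp
  also have "set (filter (\<lambda>l. l \<noteq> i) [0..<m]) = {..<m} - {i}" by auto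
  also have "card \<dots> = m - 1" using assms by simp
  finally show ?thesis .
qed

lemma set_ta_history:
  assumes "e \<in> set (ta_history m D (d * (m * m)))"
  obtains q i where "q < d" "i < m" "e = SortedAccess i (Some (D ! i ! q))"
  | q i l where "q < d" "i < m" "l < m"
      "e = RandomAccess l (fst (D ! i ! q)) (random_answer D l (fst (D ! i ! q)))"
proof -
  obtain n where n: "n < d * (m * m)" "e = ta_event m D n"
    using assms by (auto simp: ta_history_def)
  obtain q i j where qij: "n = q * (m * m) + (i * m + j)" "q < d" "i < m" "j < m"
    using access_index_cases[OF n(1)] .
  show thesis
  proof (cases "j = 0")
    case True
    then have "e = SortedAccess i (Some (D ! i ! q))"
      using ta_event_sorted[OF qij(3), of D q] n(2) qij(1) by simp
    then show ?thesis using that(1)[OF qij(2,3)] by simp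
  next
    case False
    let ?f = "filter (\<lambda>l. l \<noteq> i) [0..<m]"
    have "length ?f = m - 1"
      using qij(3) by (rule length_filter_neq)
    then have "?f ! (j - 1) \<in> set ?f"
      using False qij(4) by (intro nth_mem) simp
    then have "?f ! (j - 1) < m" by simp
    moreover have "e = RandomAccess (?f ! (j - 1)) (fst (D ! i ! q))
        (random_answer D (?f ! (j - 1)) (fst (D ! i ! q)))"
      using ta_event_random[OF qij(3) _ qij(4), of D q] False n(2) qij(1) by simp
    ultimately show ?thesis by (rule that(2)[OF qij(2,3)])
  qed
qed

lemma sorted_in_ta_history:
  assumes "i < m" "q < d"
  shows "SortedAccess i (Some (D ! i ! q)) \<in> set (ta_history m D (d * (m * m)))"
proof -
  have "q * (m * m) + i * m < Suc q * (m * m)" using assms by simp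
  also have "\<dots> \<le> d * (m * m)" using assms by (intro mult_le_mono1) simp
  finally show ?thesis
    using ta_event_sorted[OF assms(1), of D q] by (force simp: ta_history_def)
qed

lemma random_in_ta_history:
  assumes "i < m" "q < d" "l < m" "l \<noteq> i"
  shows "RandomAccess l (fst (D ! i ! q)) (random_answer D l (fst (D ! i ! q)))
    \<in> set (ta_history m D (d * (m * m)))"
proof -
  let ?f = "filter (\<lambda>l. l \<noteq> i) [0..<m]"
  have len: "length ?f = m - 1"
    using assms(1) by (rule length_filter_neq)
  have "l \<in> set ?f" using assms by simp
  then obtain j where j: "j < m - 1" "?f ! j = l"
    using len by (metis in_set_conv_nth)
  then have jm: "Suc j < m" by simp
  have "q * (m * m) + (i * m + Suc j) < Suc q * (m * m)"
    using offset_less[OF assms(1) jm] by simp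
  also have "\<dots> \<le> d * (m * m)" using assms by (intro mult_le_mono1) simp
  finally show ?thesis
    using ta_event_random[OF assms(1) _ jm, of D q] j by (force simp: ta_history_def)
qed

lemma seen_ta_history:
  "seen (ta_history m D (d * (m * m))) = {fst (D ! i ! q) | i q. i < m \<and> q < d}"
proof (intro equalityI subsetI)
  fix R assume "R \<in> seen (ta_history m D (d * (m * m)))"
  then obtain i x where "SortedAccess i (Some (R, x)) \<in> set (ta_history m D (d * (m * m)))"
    by (auto simp: seen_def)
  then show "R \<in> {fst (D ! i ! q) | i q. i < m \<and> q < d}"
    by (rule set_ta_history) (auto, metis fst_conv)
next
  fix R assume "R \<in> {fst (D ! i ! q) | i q. i < m \<and> q < d}"
  then obtain i q where "i < m" "q < d" "R = fst (D ! i ! q)" by auto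
  then show "R \<in> seen (ta_history m D (d * (m * m)))"
    using sorted_in_ta_history[of i m q d D] by (auto simp: seen_def) (metis prod.collapse)
qed

text \<open>The description by \<open>THE\<close> is well defined: every recorded grade agrees with
  the database (\<open>sound\<close>), and full rounds record all grades of a seen object
  (\<open>complete\<close>), one by the sorted access that showed it and the others by the random
  accesses that follow.\<close>

lemma known_grade_ta_history:
  assumes D: "D \<in> databases m k" and d: "d \<le> card (objects D)" and l: "l < m"
    and R: "R \<in> seen (ta_history m D (d * (m * m)))"
  shows "known_grade (ta_history m D (d * (m * m))) l R = the (map_of (D ! l) R)"
proof -
  let ?h = "ta_history m D (d * (m * m))"
  have len: "length D = m" using databaseD(1)[OF D] .
  have sound: "map_of (D ! l) R = Some x"
    if "SortedAccess l (Some (R, x)) \<in> set ?h \<or> RandomAccess l R (Some x) \<in> set ?h" for x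
    using that
  proof
    assume "SortedAccess l (Some (R, x)) \<in> set ?h"
    then show ?thesis
    proof (rule set_ta_history)
      fix q i assume "q < d" "i < m" "SortedAccess l (Some (R, x)) = SortedAccess i (Some (D ! i ! q))"
      then show ?thesis
        using nth_in_objects(4)[OF D, of i q] d by (cases "D ! i ! q") auto
    qed auto
  next
    assume "RandomAccess l R (Some x) \<in> set ?h"
    then show ?thesis
      by (rule set_ta_history) (use len in \<open>auto simp: random_answer_def\<close>)
  qed
  obtain i q where iq: "i < m" "q < d" "R = fst (D ! i ! q)"
    using R by (auto simp: seen_ta_history)
  have "R \<in> objects D" using iq d nth_in_objects(1)[OF D] by simp
  then obtain x where x: "map_of (D ! l) R = Some x"
    using objects_nth[OF D l] nth_in_objects(4)[OF D l] by metis
  have complete: "SortedAccess l (Some (R, x)) \<in> set ?h \<or> RandomAccess l R (Some x) \<in> set ?h"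
  proof (cases "l = i")
    case True
    have "map_of (D ! i) R = Some (snd (D ! i ! q))"
      using nth_in_objects(4)[OF D iq(1), of q] iq d by simp
    then have "D ! i ! q = (R, x)" using x True iq(3) by (simp add: prod_eq_iff)
    then show ?thesis using sorted_in_ta_history[OF iq(1,2), of D] True by simp
  next
    case False
    then show ?thesis
      using random_in_ta_history[OF iq(1,2) l False, of D] x iq len l
      by (simp add: random_answer_def)
  qed
  show ?thesis
    unfolding known_grade_def
    by (rule the_equality) (use complete x sound in auto)
qed

lemma known_overall_ta_history:
  assumes D: "D \<in> databases m k" and d: "d \<le> card (objects D)"
    and R: "R \<in> seen (ta_history m D (d * (m * m)))"
  shows "known_overall m t (ta_history m D (d * (m * m))) R = overall_grade t D R"
proof -
  have "map (\<lambda>l. known_grade (ta_history m D (d * (m * m))) l R) [0..<m] =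
      map (\<lambda>l. the (map_of (D ! l) R)) [0..<m]"
    using known_grade_ta_history[OF D d _ R] by simp
  then show ?thesis
    by (simp only: known_overall_def overall_grade_eq[OF databaseD(1)[OF D]])
qed

lemma threshold_ta_history:
  assumes "0 < d"
  shows "threshold m t (ta_history m D (d * (m * m))) =
    t (map (\<lambda>i. snd (D ! i ! (d - 1))) [0..<m])"
proof -
  have "map (last_grade (ta_history m D (d * (m * m)))) [0..<m] =
      map (\<lambda>i. snd (D ! i ! (d - 1))) [0..<m]"
    using last_grade_ta_history[of _ m D "d - 1"] assms by simp
  then show ?thesis by (simp only: threshold_def)
qed

section \<open>Seen objects, grades and thresholds\<close>

lemma seen_ta_history_subset:
  assumes "D \<in> databases m k" "d \<le> card (objects D)"
  shows "seen (ta_history m D (d * (m * m))) \<subseteq> objects D"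
  unfolding seen_ta_history using nth_in_objects(1)[OF assms(1)] assms(2) by auto

lemma seen_ta_history_all:
  assumes "D \<in> databases m k" "1 \<le> m"
  shows "seen (ta_history m D (card (objects D) * (m * m))) = objects D"
proof
  show "objects D \<subseteq> seen (ta_history m D (card (objects D) * (m * m)))"
  proof
    fix R assume "R \<in> objects D"
    with assms obtain p where "p < card (objects D)" "fst (D ! 0 ! p) = R"
      using objects_nth[of D m k 0 R] by auto
    then show "R \<in> seen (ta_history m D (card (objects D) * (m * m)))"
      unfolding seen_ta_history using assms(2)
      by (intro CollectI exI[of _ 0] exI[of _ p]) auto
  qed
qed (rule seen_ta_history_subset[OF assms(1) order_refl])

text \<open>In every list an unseen object lies at position \<open>d\<close> or later, so its grades
  are bounded by the last ones read, and \<open>t\<close> is monotone.\<close>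

lemma unseen_grade_le_threshold:
  assumes D: "D \<in> databases m k" and mono: "monotone_aggregation m t"
    and d: "0 < d" "d \<le> card (objects D)"
    and z: "z \<in> objects D" "z \<notin> seen (ta_history m D (d * (m * m)))"
  shows "overall_grade t D z \<le> threshold m t (ta_history m D (d * (m * m)))"
  unfolding threshold_ta_history[OF d(1)] overall_grade_eq[OF databaseD(1)[OF D]]
proof (intro monotone_aggregationD[OF mono] grade_vector_nth[OF D] grade_vector_object[OF D z(1)])
  fix i assume i: "i < m"
  obtain p where p: "p < card (objects D)" "fst (D ! i ! p) = z"
    using objects_nth[OF D i z(1)] .
  then have "d \<le> p" using z(2) i by (force simp: seen_ta_history)
  then have "snd (D ! i ! p) \<le> snd (D ! i ! (d - 1))"
    using nth_grade_antimono[OF D i, of "d - 1" p] p(1) by simp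
  then show "the (map_of (D ! i) z) \<le> snd (D ! i ! (d - 1))"
    using nth_in_objects(4)[OF D i p(1)] p(2) by simp
qed (use d in simp)

text \<open>At full depth the last grades read are the smallest of each list.\<close>

lemma threshold_le_all:
  assumes D: "D \<in> databases m k" and mono: "monotone_aggregation m t"
    and R: "R \<in> objects D"
  shows "threshold m t (ta_history m D (card (objects D) * (m * m))) \<le> overall_grade t D R"
proof -
  have pos: "0 < card (objects D)"
    using R finite_objects[of D] by (auto simp: card_gt_0_iff)
  show ?thesis
    unfolding threshold_ta_history[OF pos] overall_grade_eq[OF databaseD(1)[OF D]]
  proof (intro monotone_aggregationD[OF mono] grade_vector_nth[OF D] grade_vector_object[OF D R])
    fix i assume i: "i < m"
    obtain p where p: "p < card (objects D)" "fst (D ! i ! p) = R"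
      using objects_nth[OF D i R] .
    then have "snd (D ! i ! (card (objects D) - 1)) \<le> snd (D ! i ! p)"
      using nth_grade_antimono[OF D i, of p "card (objects D) - 1"] by simp
    then show "snd (D ! i ! (card (objects D) - 1)) \<le> the (map_of (D ! i) R)"
      using nth_in_objects(4)[OF D i p(1)] p(2) by simp
  qed (use pos in simp)
qed

section \<open>Halting of the threshold algorithm\<close>

text \<open>The rule is assumed to fail only strictly before \<open>n\<close>, because the first
  \<open>n\<close> accesses do not depend on the test made after them. The bound on \<open>n\<close>
  keeps all sorted accesses within the lists.\<close>

lemma run_TA:
  assumes D: "D \<in> databases m k" and n: "n \<le> card (objects D) * (m * m)"
    and go: "\<And>d. 0 < d \<Longrightarrow> d * (m * m) < n \<Longrightarrow>
      \<not> stopping_rule \<theta> m k t (ta_history m D (d * (m * m)))"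
  shows "run (TA \<theta> m k t sel) D n = ta_history m D n"
  using n go
proof (induction n)
  case 0
  then show ?case by (simp add: ta_history_def)
next
  case (Suc n)
  let ?h = "ta_history m D n"
  have IH: "run (TA \<theta> m k t sel) D n = ?h" using Suc by simp
  obtain q i j where qij: "n = q * (m * m) + (i * m + j)" "q < card (objects D)" "i < m" "j < m"
    using access_index_cases[of n "card (objects D)" m] Suc.prems(1) by auto
  note idx = access_index[OF qij(3,4), of q]
  have len: "length ?h = n" by (simp add: ta_history_def)
  \<comment> \<open>The test takes place only between rounds and not at the start; there the depth
    \<open>q\<close> is positive and the assumption rules out halting.\<close>
  have go: "\<not> (i * m + j = 0 \<and> ?h \<noteq> [] \<and> stopping_rule \<theta> m k t ?h)"
  proof
    assume *: "i * m + j = 0 \<and> ?h \<noteq> [] \<and> stopping_rule \<theta> m k t ?h"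
    then have "n = q * (m * m)" using qij(1) by simp
    moreover have "0 < n" using * len by (metis length_greater_0_conv)
    ultimately have "n = q * (m * m)" "0 < q" by (simp_all add: gr0_conv_Suc) (cases q; simp)
    then show False using Suc.prems(2)[of q] * by simp
  qed
  have r: "n mod (m * m) = i * m + j" "(i * m + j) div m = i" "(i * m + j) mod m = j"
    using idx(2) qij(1,4) by simp_all
  have act: "TA \<theta> m k t sel ?h = (if j = 0 then Sorted i
      else Random (filter (\<lambda>l. l \<noteq> i) [0..<m] ! (j - 1)) (last_object ?h))"
    unfolding TA_def Let_def len r by (rule if_not_P[OF go])
  show ?case
  proof (cases "j = 0")
    case True
    then have "sorted_answer D ?h i = Some (D ! i ! q)"
      using sorted_count_ta_history[OF qij(3), of D q] qij databaseD(1,7)[OF D]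
      by (simp add: sorted_answer_eq list_entry_def)
    moreover have "ta_event m D n = SortedAccess i (Some (D ! i ! q))"
      using ta_event_sorted[OF qij(3), of D q] True qij(1) by simp
    ultimately show ?thesis
      using act True by (simp add: IH ta_history_Suc)
  next
    case False
    have "last_object ?h = fst (D ! i ! q)"
      using last_object_ta_history[OF qij(3) _ qij(4), of D q] False qij(1) by simp
    moreover have "ta_event m D n =
        RandomAccess (filter (\<lambda>l. l \<noteq> i) [0..<m] ! (j - 1)) (fst (D ! i ! q))
          (random_answer D (filter (\<lambda>l. l \<noteq> i) [0..<m] ! (j - 1)) (fst (D ! i ! q)))"
      using ta_event_random[OF qij(3) _ qij(4), of D q] False qij(1) by simp
    ultimately show ?thesis
      using act False by (simp add: IH ta_history_Suc)
  qed
qed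

text \<open>The threshold is nonnegative, so dividing it by \<open>\<theta>\<close> does not raise
  it, and at full depth it is at most every overall grade. Hence all objects pass the test.\<close>

lemma stopping_rule_all:
  assumes D: "D \<in> databases m k" and m: "1 \<le> m" and k: "1 \<le> k" and \<theta>: "1 < \<theta>"
    and agg: "aggregation_function m t" and mono: "monotone_aggregation m t"
  shows "stopping_rule \<theta> m k t (ta_history m D (card (objects D) * (m * m)))"
proof -
  let ?h = "ta_history m D (card (objects D) * (m * m))"
  have pos: "0 < card (objects D)" using databaseD(2)[OF D] k by simp
  have "0 \<le> threshold m t ?h"
    unfolding threshold_ta_history[OF pos]
    using agg grade_vector_nth[OF D, of "\<lambda>_. card (objects D) - 1"] pos
    by (simp add: aggregation_function_def)
  then have "threshold m t ?h / \<theta> \<le> threshold m t ?h"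
    using \<theta> by (simp add: divide_le_eq mult_right_le_one_le mult_le_cancel_left1)
  then have "threshold m t ?h / \<theta> \<le> known_overall m t ?h R" if "R \<in> seen ?h" for R
    using threshold_le_all[OF D mono, of R] that known_overall_ta_history[OF D order_refl that, of t]
    by (simp add: seen_ta_history_all[OF D m])
  then have "{R \<in> seen ?h. threshold m t ?h / \<theta> \<le> known_overall m t ?h R} = objects D"
    using seen_ta_history_all[OF D m] by auto
  then show ?thesis
    using databaseD(2)[OF D] by (simp add: stopping_rule_def)
qed

text \<open>\<open>d\<close> is the first depth at which the stopping rule holds; it exists because
  the rule holds at full depth.\<close>

lemma TA_halts:
  assumes D: "D \<in> databases m k" and m: "1 \<le> m" and k: "1 \<le> k" and \<theta>: "1 < \<theta>"
    and agg: "aggregation_function m t" and mono: "monotone_aggregation m t"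
  obtains d where "0 < d" "d \<le> card (objects D)"
    "stopping_rule \<theta> m k t (ta_history m D (d * (m * m)))"
    "\<And>d'. 0 < d' \<Longrightarrow> stopping_rule \<theta> m k t (ta_history m D (d' * (m * m))) \<Longrightarrow> d \<le> d'"
    "final_history (TA \<theta> m k t sel) D = ta_history m D (d * (m * m))"
    "halts (TA \<theta> m k t sel) D"
    "TA \<theta> m k t sel (ta_history m D (d * (m * m))) =
      Halt ((\<lambda>R. (R, known_overall m t (ta_history m D (d * (m * m))) R)) `
        sel (ta_history m D (d * (m * m))))"
proof -
  let ?P = "\<lambda>d. 0 < d \<and> stopping_rule \<theta> m k t (ta_history m D (d * (m * m)))"
  define d where "d = (LEAST d. ?P d)"
  have all: "?P (card (objects D))"
    using stopping_rule_all[OF assms] databaseD(2)[OF D] k by simp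
  have d: "?P d" unfolding d_def using all by (rule LeastI)
  have least: "d \<le> d'" if "?P d'" for d' unfolding d_def using that by (rule Least_le)
  let ?h = "ta_history m D (d * (m * m))"
  have "length ?h = d * (m * m)" by (simp add: ta_history_def)
  then have halt: "TA \<theta> m k t sel ?h = Halt ((\<lambda>R. (R, known_overall m t ?h R)) ` sel ?h)"
    using d m by (auto simp: TA_def Let_def)
  have run: "run (TA \<theta> m k t sel) D (d * (m * m)) = ?h"
  proof (rule run_TA[OF D])
    show "d * (m * m) \<le> card (objects D) * (m * m)"
      using least[OF all] by (rule mult_le_mono1)
    fix d' assume "0 < d'" "d' * (m * m) < d * (m * m)"
    then have "d' < d" using mult_less_cancel2 by blast
    then show "\<not> stopping_rule \<theta> m k t (ta_history m D (d' * (m * m)))"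
      using least[of d'] \<open>0 < d'\<close> by auto
  qed
  show thesis
  proof (rule that)
    show "final_history (TA \<theta> m k t sel) D = ?h"
      using final_history_eq[of "TA \<theta> m k t sel" D "d * (m * m)"] run halt by simp
    show "halts (TA \<theta> m k t sel) D"
    proof -
      have "\<exists>out. TA \<theta> m k t sel (run (TA \<theta> m k t sel) D (d * (m * m))) = Halt out"
        unfolding run halt by blast
      then show ?thesis unfolding halts_def ..
    qed
    show "d \<le> d'" if "0 < d'" "stopping_rule \<theta> m k t (ta_history m D (d' * (m * m)))" for d'
      using least that by simp
  qed (use d least[OF all] halt in simp_all)
qed

section \<open>Correctness of the threshold algorithm\<close>

text \<open>A random access always concerns the object shown by the sorted access that opens its
  block of \<open>m\<close> accesses, which comes earlier in the history.\<close>

lemma no_wild_guess_ta_history: "\<not> wild_guess (ta_history m D (d * (m * m)))"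
proof
  assume "wild_guess (ta_history m D (d * (m * m)))"
  then obtain h1 l R a h2 where h: "ta_history m D (d * (m * m)) = h1 @ RandomAccess l R a # h2"
    and R: "R \<notin> seen h1"
    unfolding wild_guess_def by blast
  define n where "n = length h1"
  have "n < length (ta_history m D (d * (m * m)))" by (simp add: h n_def)
  then have n: "n < d * (m * m)" by (simp add: ta_history_def)
  have ev: "ta_event m D n = RandomAccess l R a"
  proof -
    have "ta_history m D (d * (m * m)) ! n = RandomAccess l R a" by (simp add: h n_def)
    then show ?thesis using n by (simp add: ta_history_def)
  qed
  have h1: "h1 = map (ta_event m D) [0..<n]"
  proof -
    have "h1 = take n (ta_history m D (d * (m * m)))" by (simp add: h n_def)
    then show ?thesis using n by (simp add: ta_history_def take_map)
  qed
  obtain q i j where qij: "n = q * (m * m) + (i * m + j)" "q < d" "i < m" "j < m"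
    using access_index_cases[OF n] .
  have j: "0 < j"
    using ev ta_event_sorted[OF qij(3), of D q] qij(1) by (cases j) auto
  then have "R = fst (D ! i ! q)"
    using ev ta_event_random[OF qij(3) j qij(4), of D q] qij(1) by simp
  moreover have "SortedAccess i (Some (D ! i ! q)) \<in> set h1"
    unfolding h1 ta_event_sorted[OF qij(3), of D q, symmetric]
    using j qij(1) by (auto intro!: imageI)
  ultimately show False
    using R by (cases "D ! i ! q") (auto simp: seen_def)
qed

text \<open>A seen object that is not selected has at most the grade of any selected one. An unseen
  object is bounded by the threshold, which is at most \<open>\<theta>\<close> times any selected
  grade because selected objects pass the test (\<open>selB\<close>).\<close>

lemma theta_approximation_TA:
  assumes D: "D \<in> databases m k" and \<theta>: "1 < \<theta>"
    and agg: "aggregation_function m t" and mono: "monotone_aggregation m t"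
    and sel: "top_choice m k t sel"
    and d: "0 < d" "d \<le> card (objects D)"
  defines "h \<equiv> ta_history m D (d * (m * m))"
  assumes stop: "stopping_rule \<theta> m k t h"
  shows "theta_approximation \<theta> k t D ((\<lambda>R. (R, known_overall m t h R)) ` sel h)"
proof -
  define B where "B = {R \<in> seen h. threshold m t h / \<theta> \<le> known_overall m t h R}"
  have B: "B \<subseteq> seen h" "k \<le> card B" "finite B"
    using stop finite_seen[of h] by (auto simp: B_def stopping_rule_def)
  then have "k \<le> card (seen h)" using card_mono[OF finite_seen B(1)] by simp
  then have s: "sel h \<subseteq> seen h" "card (sel h) = k"
    "\<And>y z. y \<in> sel h \<Longrightarrow> z \<in> seen h - sel h \<Longrightarrow> known_overall m t h z \<le> known_overall m t h y"
    using sel unfolding top_choice_def by blast+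
  have sub: "seen h \<subseteq> objects D"
    unfolding h_def by (rule seen_ta_history_subset[OF D d(2)])
  have known: "known_overall m t h R = overall_grade t D R" if "R \<in> seen h" for R
    using known_overall_ta_history[OF D d(2)] that by (simp add: h_def)
  \<comment> \<open>A selected object failing the test would be strictly worse than all of
    \<open>B\<close>, so the choice would contain \<open>B\<close> and this object as well, hence
    more than \<open>k\<close> objects.\<close>
  have selB: "sel h \<subseteq> B"
  proof (rule ccontr)
    assume "\<not> sel h \<subseteq> B"
    then obtain y where y: "y \<in> sel h" "y \<notin> B" by blast
    have "B \<subseteq> sel h"
    proof
      fix z assume z: "z \<in> B"
      show "z \<in> sel h"
      proof (rule ccontr)
        assume "z \<notin> sel h"
        then have "known_overall m t h z \<le> known_overall m t h y"
          using s(3)[OF y(1)] z B(1) by blast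
        then show False using z y s(1) by (auto simp: B_def)
      qed
    qed
    then have "B \<subset> sel h" using y by blast
    then have "card B < card (sel h)"
      using finite_subset[OF s(1) finite_seen] by (intro psubset_card_mono)
    then show False using B(2) s(2) by simp
  qed
  have "overall_grade t D z \<le> \<theta> * overall_grade t D y"
    if y: "y \<in> sel h" and z: "z \<in> objects D - sel h" for y z
  proof (cases "z \<in> seen h")
    case True
    have "overall_grade t D z \<le> overall_grade t D y"
      using s(3)[OF y, of z] known[of y] known[of z] True y z s(1) by auto
    \<comment> \<open>Nonnegativity of grades allows the factor \<open>\<theta>\<close> to be
      inserted.\<close>
    also have "\<dots> \<le> \<theta> * overall_grade t D y"
      using overall_grade_nonneg[OF agg D, of y] y s(1) sub \<theta>
      by (intro mult_right_mono[of 1 \<theta>, simplified]) auto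
    finally show ?thesis .
  next
    case False
    have "overall_grade t D z \<le> threshold m t h"
      using unseen_grade_le_threshold[OF D mono d] z False by (simp add: h_def)
    also have "\<dots> \<le> \<theta> * overall_grade t D y"
    proof -
      have "threshold m t h / \<theta> \<le> known_overall m t h y" using selB y by (auto simp: B_def)
      then show ?thesis using known[of y] y s(1) \<theta> by (auto simp: field_simps)
    qed
    finally show ?thesis .
  qed
  moreover have "(\<lambda>R. (R, known_overall m t h R)) ` sel h = (\<lambda>R. (R, overall_grade t D R)) ` sel h"
    using known s(1) by (intro image_cong) auto
  ultimately show ?thesis
    unfolding theta_approximation_def using s(1,2) sub by (intro exI[of _ "sel h"]) auto
qed

section \<open>Instance optimality\<close>

text \<open>Charging every access with both prices avoids counting the two kinds separately and
  loses only a constant factor.\<close>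

lemma cost_upper_bound:
  assumes "0 < cS" "0 < cR"
  shows "cost cS cR A D \<le> real (length (final_history A D)) * (cS + cR)"
proof -
  let ?h = "final_history A D"
  have "real (length (filter is_sorted_access ?h)) * cS \<le> real (length ?h) * cS"
    "real (length (filter (\<lambda>e. \<not> is_sorted_access e) ?h)) * cR \<le> real (length ?h) * cR"
    using assms by (auto intro: mult_right_mono)
  then show ?thesis unfolding cost_def Let_def distrib_left by (rule add_mono)
qed

theorem theorem6p7:
  fixes m k :: nat
    and \<theta> cS cR :: real
    and t :: "real list \<Rightarrow> real"
    and sel :: "'o history \<Rightarrow> 'o set"
  assumes "m \<ge> 1" and "k \<ge> 1"
    and "cS > 0" and "cR > 0"
    and "\<theta> > 1"
    and "aggregation_function m t"
    and "monotone_aggregation m t"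
    and "top_choice m k t sel"
  shows "instance_optimal (cost cS cR) (TA \<theta> m k t sel)
           (approximation_algorithms \<theta> m k t \<inter> no_wild_guess_algorithms m k)
           (databases m k)"
proof -
  let ?TA = "TA \<theta> m k t sel"
  \<comment> \<open>A bound for the cost of one round: \<open>m * m\<close> accesses, each charged
    \<open>cS + cR\<close>.\<close>
  let ?w = "real (m * m) * (cS + cR)"
  have "?TA \<in> approximation_algorithms \<theta> m k t"
    unfolding approximation_algorithms_def
  proof (intro CollectI ballI)
    fix D :: "'o database" assume D: "D \<in> databases m k"
    show "halts ?TA D \<and>
      (\<exists>out. ?TA (final_history ?TA D) = Halt out \<and> theta_approximation \<theta> k t D out)"
    proof (rule TA_halts[where sel = sel, OF D assms(1,2,5,6,7)])
      fix d assume "0 < d" "d \<le> card (objects D)"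
        "stopping_rule \<theta> m k t (ta_history m D (d * (m * m)))"
        and fin: "final_history ?TA D = ta_history m D (d * (m * m))"
        and "halts ?TA D"
        and "?TA (ta_history m D (d * (m * m))) =
          Halt ((\<lambda>R. (R, known_overall m t (ta_history m D (d * (m * m))) R)) `
            sel (ta_history m D (d * (m * m))))"
      then show ?thesis
        unfolding fin using theta_approximation_TA[OF D assms(5-8), of d] by simp
    qed
  qed
  moreover have "?TA \<in> no_wild_guess_algorithms m k"
    unfolding no_wild_guess_algorithms_def
  proof (intro CollectI ballI)
    fix D :: "'o database" assume D: "D \<in> databases m k"
    show "\<not> wild_guess (final_history ?TA D)"
      by (rule TA_halts[where sel = sel, OF D assms(1,2,5,6,7)]) (simp add: no_wild_guess_ta_history)
  qed
  \<comment> \<open>The factor converts the price of a sorted access of \<open>A\<close> into that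
    of a round of \<open>TA\<close>; the additive constant pays for \<open>k\<close> further
    rounds.\<close>
  moreover have "cost cS cR ?TA D \<le> (?w / cS) * cost cS cR A D + ?w * real k"
    if A: "A \<in> approximation_algorithms \<theta> m k t" "A \<in> no_wild_guess_algorithms m k"
      and D: "D \<in> databases m k" for A and D :: "'o database"
  proof -
    define s where "s = length (filter is_sorted_access (final_history A D))"
    obtain d where d: "0 < d" "d \<le> card (objects D)"
      and least: "\<And>d'. 0 < d' \<Longrightarrow> stopping_rule \<theta> m k t (ta_history m D (d' * (m * m))) \<Longrightarrow> d \<le> d'"
      and fin: "final_history ?TA D = ta_history m D (d * (m * m))"
      by (rule TA_halts[where sel = sel, OF D assms(1,2,5,6,7)]) (rule that; simp)
    have "d \<le> s + k"
    proof (cases "s + k < card (objects D)")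
      case True
      obtain Y where Y: "Y \<subseteq> {fst (D ! i ! q) | i q. i < m \<and> q < s}" "card Y = k"
        "\<forall>y\<in>Y. t (map (\<lambda>i. snd (D ! i ! s)) [0..<m]) \<le> \<theta> * overall_grade t D y"
        using lower_bound[OF assms(1) D assms(7) A True[unfolded s_def], folded s_def]
        by (elim exE conjE)
      let ?h = "ta_history m D (Suc s * (m * m))"
      have seen: "Y \<subseteq> seen ?h"
      proof
        fix y assume "y \<in> Y"
        then obtain i q where "i < m" "q < s" "y = fst (D ! i ! q)" using Y(1) by blast
        then show "y \<in> seen ?h"
          unfolding seen_ta_history by (intro CollectI exI[of _ i] exI[of _ q]) simp
      qed
      have "threshold m t ?h / \<theta> \<le> known_overall m t ?h y" if "y \<in> Y" for y
      proof -
        have "known_overall m t ?h y = overall_grade t D y"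
          using True assms(2) subsetD[OF seen that] by (intro known_overall_ta_history[OF D]) simp_all
        moreover have "threshold m t ?h = t (map (\<lambda>i. snd (D ! i ! s)) [0..<m])"
          using threshold_ta_history[of "Suc s" m t D] by simp
        ultimately show ?thesis
          using bspec[OF Y(3) that] assms(5) by (simp add: field_simps)
      qed
      with seen have "Y \<subseteq> {R \<in> seen ?h. threshold m t ?h / \<theta> \<le> known_overall m t ?h R}"
        by blast
      then have "card Y \<le> card {R \<in> seen ?h. threshold m t ?h / \<theta> \<le> known_overall m t ?h R}"
        by (intro card_mono finite_subset[OF _ finite_seen[of ?h]]) auto
      then have "stopping_rule \<theta> m k t ?h" by (simp only: stopping_rule_def Y(2))
      with least[of "Suc s"] have "d \<le> Suc s" by simp
      \<comment> \<open>Here \<open>Suc s \<le> s + k\<close> because \<open>k\<close> is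
        positive.\<close>
      then show ?thesis using assms(2) by simp
    qed (use d(2) in simp)
    have "cost cS cR ?TA D \<le> real (d * (m * m)) * (cS + cR)"
      using cost_upper_bound[OF assms(3,4), of ?TA D] by (simp add: fin ta_history_def)
    also have "\<dots> = ?w * real d" by simp
    also have "\<dots> \<le> ?w * (real s + real k)"
      using \<open>d \<le> s + k\<close> assms(3,4) by (intro mult_left_mono) auto
    also have "\<dots> = (?w / cS) * (real s * cS) + ?w * real k"
      using assms(3) by (simp add: field_simps)
    also have "\<dots> \<le> (?w / cS) * cost cS cR A D + ?w * real k"
    proof -
      \<comment> \<open>The random accesses of \<open>A\<close> only add to its cost, so the sorted
        ones alone give the bound.\<close>
      have "real s * cS \<le> cost cS cR A D"
        using assms(4) by (simp add: cost_def Let_def s_def)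
      then show ?thesis
        using assms(3,4) by (intro add_right_mono mult_left_mono) auto
    qed
    finally show ?thesis .
  qed
  ultimately show ?thesis
    unfolding instance_optimal_def
    by (intro conjI exI[of _ "?w / cS"] exI[of _ "?w * real k"] IntI ballI) (simp_all only: Int_iff)
qed

end
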